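(* Let $\alpha<\beta$ and $a<b$ be real numbers, and let $y:[a,b]\to\mathbb{R}$ be a continuous piecewise linear function (with finitely many pieces). For $(u,v)\in\mathbb{R}^2$ let $t(u,v)$ be the number of crossings (upcrossings and downcrossings together) by the graph of $y$ of the gap between the slopes $\alpha$ and $\beta$ with vertex $(u,v)$, and let $T(u)=\max_{v\in\mathbb{R}}t(u,v)$. Then $$\int_{\mathbb{R}} T(u)\,du\le\frac{1}{\beta-\alpha}\int_a^b \tau_{\alpha,\beta}(y'(x))\,dx,$$ where $\tau_{\alpha,\beta}(s)=s-\alpha$ for $s\ge\beta$, $\tau_{\alpha,\beta}(s)=\beta-\alpha$ for $\alpha\le s\le\beta$, and $\tau_{\alpha,\beta}(s)=\beta-s$ for $s\le\alpha$.
   Context: The gap with vertex $(u,v)$ is the angle formed by the two rays going to the right from $(u,v)$ with slopes $\alpha$ (the $\alpha$-ray) and $\beta$ (the $\beta$-ray). A point $(x,y(x))$ of the graph with $x>u$ is below the $\alpha$-ray if $y(x)<v+\alpha(x-u)$, and above the $\beta$-ray if $y(x)>v+\beta(x-u)$. The number of crossings $t(u,v)$ is the maximal $m\ge 0$ for which there is a sequence of points $c_0,\dots,c_m$ on the graph of $y$, with strictly increasing first coordinates (all greater than $u$), that alternate between being below the $\alpha$-ray and being above the $\beta$-ray (the sequence may start with either kind); $t(u,v)=0$ if there is no such sequence. The derivative $y'(x)$ is defined for all but finitely many $x\in[a,b]$. *)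

theory Defs
  imports "HOL-Analysis.Analysis"
begin

text \<open>The values of \<open>y\<close> at the breakpoints are not constrained here; continuity on \<open>{a..b}\<close> is
  a separate hypothesis.\<close>

definition piecewise_linear_on :: "real \<Rightarrow> real \<Rightarrow> (real \<Rightarrow> real) \<Rightarrow> bool" where
  "piecewise_linear_on a b y \<longleftrightarrow>
     (\<exists>(n::nat) (p :: nat \<Rightarrow> real).
        p 0 = a \<and> p n = b \<and> (\<forall>i<n. p i < p (Suc i)) \<and>
        (\<forall>i<n. \<exists>k d. \<forall>x\<in>{p i<..<p (Suc i)}. y x = k * x + d))"

definition below_alpha_ray :: "real \<Rightarrow> real \<Rightarrow> real \<Rightarrow> real \<times> real \<Rightarrow> bool" where
  "below_alpha_ray \<alpha> u v = (\<lambda>(x, z). u < x \<and> z < v + \<alpha> * (x - u))"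

definition above_beta_ray :: "real \<Rightarrow> real \<Rightarrow> real \<Rightarrow> real \<times> real \<Rightarrow> bool" where
  "above_beta_ray \<beta> u v = (\<lambda>(x, z). u < x \<and> z > v + \<beta> * (x - u))"

text \<open>The sequence of points \<open>c\<^sub>0, \<dots>, c\<^sub>m\<close> on the graph is given by its first coordinates
  \<open>x 0, \<dots>, x m\<close>.\<close>

definition alternating_sequence ::
  "real \<Rightarrow> real \<Rightarrow> real \<Rightarrow> real \<Rightarrow> (real \<Rightarrow> real) \<Rightarrow> real \<Rightarrow> real \<Rightarrow> nat \<Rightarrow> (nat \<Rightarrow> real) \<Rightarrow> bool" where
  "alternating_sequence \<alpha> \<beta> a b y u v m x \<longleftrightarrow>
     (\<forall>i\<le>m. x i \<in> {a..b}) \<and> (\<forall>i<m. x i < x (Suc i)) \<and>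
     ((\<forall>i\<le>m. if even i then below_alpha_ray \<alpha> u v (x i, y (x i))
                        else above_beta_ray \<beta> u v (x i, y (x i))) \<or>
      (\<forall>i\<le>m. if even i then above_beta_ray \<beta> u v (x i, y (x i))
                        else below_alpha_ray \<alpha> u v (x i, y (x i))))"

definition crossing_counts ::
  "real \<Rightarrow> real \<Rightarrow> real \<Rightarrow> real \<Rightarrow> (real \<Rightarrow> real) \<Rightarrow> real \<Rightarrow> real \<Rightarrow> nat set" where
  "crossing_counts \<alpha> \<beta> a b y u v = {m. \<exists>x. alternating_sequence \<alpha> \<beta> a b y u v m x}"

text \<open>\<open>Max\<close> is meaningful only on finite sets; for the functions considered, the finiteness of the
  sets in the next two definitions is part of the theorem.\<close>

definition num_crossings ::
  "real \<Rightarrow> real \<Rightarrow> real \<Rightarrow> real \<Rightarrow> (real \<Rightarrow> real) \<Rightarrow> real \<Rightarrow> real \<Rightarrow> nat" where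
  "num_crossings \<alpha> \<beta> a b y u v =
     (if crossing_counts \<alpha> \<beta> a b y u v = {} then 0 else Max (crossing_counts \<alpha> \<beta> a b y u v))"

definition max_crossings ::
  "real \<Rightarrow> real \<Rightarrow> real \<Rightarrow> real \<Rightarrow> (real \<Rightarrow> real) \<Rightarrow> real \<Rightarrow> nat" where
  "max_crossings \<alpha> \<beta> a b y u = Max (range (\<lambda>v. num_crossings \<alpha> \<beta> a b y u v))"

definition tau :: "real \<Rightarrow> real \<Rightarrow> real \<Rightarrow> real" where
  "tau \<alpha> \<beta> s = (if s \<ge> \<beta> then s - \<alpha> else if s \<ge> \<alpha> then \<beta> - \<alpha> else \<beta> - s)"

end

theory Submission
  imports Defs
begin

text \<open>
  Write \<open>lo x = y x - \<alpha> x\<close> and \<open>hi x = y x - \<beta> x\<close>. A point over \<open>x > u\<close> is below the \<open>\<alpha>\<close>-ray of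
  \<open>(u, v)\<close> iff \<open>lo x < v - \<alpha> u\<close>, and above the \<open>\<beta>\<close>-ray iff \<open>v - \<beta> u < hi x\<close>. So a lower point \<open>l\<close> and
  an upper point \<open>h\<close> lie on the two sides of a common gap with vertex on the vertical line at \<open>u\<close>
  exactly when \<open>lo l < hi h + (\<beta> - \<alpha>) u\<close>, a condition free of \<open>v\<close>.

  This suggests to forget \<open>v\<close>: let \<open>N(u)\<close> be the maximal number of steps in an alternating sequence
  of lower and upper points to the right of \<open>u\<close> in which every two neighbours satisfy this condition,
  each pair possibly with a different \<open>v\<close>. Then \<open>T(u) \<le> N(u)\<close>, and the bound already holds for \<open>N\<close>.
  Unlike \<open>T\<close>, the number \<open>N\<close> is local enough to be followed as the graph grows to the right, one
  affine piece at a time. It is even convenient to bound slightly more, the integral of \<open>N(u)\<close> for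
  \<open>u < a\<close> plus that of \<open>max 1 N(u)\<close> for \<open>u\<close> in the part \<open>[a, b)\<close> already drawn.

  Suppose a piece of slope \<open>s\<close> over \<open>[b, c]\<close> is appended.
  \<^item> If \<open>\<alpha> \<le> s \<le> \<beta>\<close>, then \<open>N\<close> does not change at all, since the point over \<open>b\<close> is at least as good as
    any later one. The integral grows by \<open>c - b\<close> because of the unit on \<open>[b, c)\<close> (lemma \<open>flat_piece\<close>).
  \<^item> If \<open>s > \<beta>\<close>, then \<open>N\<close> increases by at most one. Consider the \<open>u < b\<close> where an increase happens that
    is not absorbed by \<open>max 1\<close>. Before the new piece their longest sequences wait in a lower
    point; let \<open>r\<close> be the least value of \<open>lo\<close> at such a point. Then \<open>r - (\<beta> - \<alpha>) u\<close> lies between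
    \<open>hi b\<close> and \<open>hi c\<close>, and it determines \<open>u\<close>. Since \<open>r\<close> is a value of \<open>lo\<close> at a breakpoint, only finitely
    many \<open>r\<close> occur, so this injection is made of finitely many scaled reflections and these
    \<open>u\<close> have measure at most \<open>(hi c - hi b) / (\<beta> - \<alpha>)\<close>. Together with \<open>[b, c)\<close> this makes
    \<open>(s - \<alpha>) (c - b) / (\<beta> - \<alpha>)\<close> (lemma \<open>steep_piece\<close>).
  \<^item> The case \<open>s < \<alpha>\<close> follows by replacing \<open>y, \<alpha>, \<beta>\<close> with \<open>-y, -\<beta>, -\<alpha>\<close>, which interchanges upper and
    lower points.

  In each case the increase is at most \<open>\<tau>(s) (c - b) / (\<beta> - \<alpha>)\<close>, and summation over the pieces gives
  the inequality.
\<close>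

section \<open>Measure of a set reflected piecewise into an interval\<close>

text \<open>Distinct pieces have disjoint images: a common value would belong to a single \<open>u\<close>, and hence
  to a single \<open>r\<close>. So the measures of the images, \<open>\<delta>\<close> times those of the pieces, add up to at most the
  length of the interval. The pieces themselves may overlap.\<close>

lemma emeasure_le_by_scaled_reflections:
  fixes F :: "real set" and S :: "real \<Rightarrow> real set" and A B \<delta> :: real
  assumes fin: "finite F" and \<delta>: "\<delta> > 0"
    and S: "\<And>r. r \<in> F \<Longrightarrow> S r \<in> sets borel"
    and into: "\<And>r u. r \<in> F \<Longrightarrow> u \<in> S r \<Longrightarrow> r - \<delta> * u \<in> {A..B}"
    and inj: "\<And>r r' u u'. r \<in> F \<Longrightarrow> r' \<in> F \<Longrightarrow> u \<in> S r \<Longrightarrow> u' \<in> S r' \<Longrightarrow>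
                r - \<delta> * u = r' - \<delta> * u' \<Longrightarrow> u = u'"
  shows "emeasure lborel (\<Union>r\<in>F. S r) \<le> ennreal ((B - A) / \<delta>)"
proof (cases "(\<Union>r\<in>F. S r) = {}")
  case True
  then show ?thesis by (simp only: emeasure_empty zero_le)
next
  case False
  with into have "A \<le> B" by fastforce
  define V where "V r = (\<lambda>u. r - \<delta> * u) ` S r" for r
  have V_vimage: "V r = (\<lambda>w. (r - w) / \<delta>) -` S r" for r
  proof (intro equalityI subsetI)
    fix w assume "w \<in> (\<lambda>w. (r - w) / \<delta>) -` S r"
    moreover have "w = r - \<delta> * ((r - w) / \<delta>)" using \<delta> by simp
    ultimately show "w \<in> V r" unfolding V_def by blast
  qed (use \<delta> in \<open>auto simp: V_def\<close>)
  have V: "V r \<in> sets borel" if "r \<in> F" for r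
  proof -
    have "(\<lambda>w. (r - w) / \<delta>) -` S r \<inter> space borel \<in> sets borel"
      by (rule measurable_sets[OF _ S[OF that]]) measurable
    then show ?thesis by (simp add: V_vimage)
  qed
  have scale: "emeasure lborel (V r) = ennreal \<delta> * emeasure lborel (S r)" if "r \<in> F" for r
  proof -
    have "emeasure lborel (V r) = (\<integral>\<^sup>+x. indicator (V r) x \<partial>lborel)"
      using V[OF that] by simp
    also have "\<dots> = ennreal \<bar>- \<delta>\<bar> * (\<integral>\<^sup>+x. indicator (V r) (r + (- \<delta>) * x) \<partial>lborel)"
      using V[OF that] \<delta> by (intro nn_integral_real_affine) auto
    also have "(\<lambda>x. indicator (V r) (r + (- \<delta>) * x) :: ennreal) = indicator (S r)"
      using \<delta> by (auto simp: fun_eq_iff V_vimage indicator_def)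
    finally show ?thesis using S[OF that] \<delta> by simp
  qed
  have disj: "disjoint_family_on V F"
    unfolding disjoint_family_on_def
  proof (intro ballI impI)
    fix r r' assume rr: "r \<in> F" "r' \<in> F" "r \<noteq> r'"
    show "V r \<inter> V r' = {}"
    proof (rule ccontr)
      assume "V r \<inter> V r' \<noteq> {}"
      then obtain u u' where u: "u \<in> S r" "u' \<in> S r'" "r - \<delta> * u = r' - \<delta> * u'"
        unfolding V_def by auto
      with inj[OF rr(1,2)] have "u = u'" by blast
      with u rr show False by simp
    qed
  qed
  have "ennreal \<delta> * emeasure lborel (\<Union>r\<in>F. S r) \<le> ennreal \<delta> * (\<Sum>r\<in>F. emeasure lborel (S r))"
    by (intro mult_left_mono emeasure_subadditive_finite) (use fin S in auto)
  also have "\<dots> = (\<Sum>r\<in>F. emeasure lborel (V r))"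
    by (simp add: sum_distrib_left scale)
  also have "\<dots> = emeasure lborel (\<Union>r\<in>F. V r)"
    by (intro sum_emeasure) (use fin V disj in auto)
  also have "\<dots> \<le> emeasure lborel {A..B}"
    by (intro emeasure_mono) (use into in \<open>auto simp: V_def\<close>)
  also have "\<dots> = ennreal (\<delta> * ((B - A) / \<delta>))" using \<open>A \<le> B\<close> \<delta> by simp
  also have "\<dots> = ennreal \<delta> * ennreal ((B - A) / \<delta>)"
    using \<open>A \<le> B\<close> \<delta> by (intro ennreal_mult) auto
  finally show ?thesis
    using \<delta> by (simp add: ennreal_mult_le_mult_iff)
qed

section \<open>Alternating sequences without a fixed vertex\<close>

locale gap =
  fixes \<alpha> \<beta> a :: real and y :: "real \<Rightarrow> real"
  assumes slopes: "\<alpha> < \<beta>"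
begin

definition lo :: "real \<Rightarrow> real" where "lo x = y x - \<alpha> * x"

definition hi :: "real \<Rightarrow> real" where "hi x = y x - \<beta> * x"

text \<open>The sequence ends in \<open>q\<close>, an upper point iff \<open>up\<close>, after \<open>k\<close> changes of side, and lies to the
  right of \<open>u\<close>. Upper and lower points that follow each other fit a common gap with vertex on
  the vertical line at \<open>u\<close>; the height of the vertex may vary from pair to pair.\<close>

primrec alternates :: "nat \<Rightarrow> bool \<Rightarrow> real \<Rightarrow> real \<Rightarrow> bool" where
  "alternates 0 up q u \<longleftrightarrow> a \<le> q \<and> u < q"
| "alternates (Suc k) up q u \<longleftrightarrow>
     (\<exists>x<q. alternates k (\<not> up) x u \<and>
        (if up then lo x < hi q + (\<beta> - \<alpha>) * u else lo q < hi x + (\<beta> - \<alpha>) * u))"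

text \<open>For \<open>k > 0\<close> this is the set where the number \<open>N\<close> of the graph up to \<open>b\<close> is at least \<open>k\<close>.\<close>

definition reach :: "nat \<Rightarrow> real \<Rightarrow> real set" where
  "reach k b = {u. \<exists>q\<le>b. \<exists>up. alternates k up q u}"

text \<open>The superlevel sets \<open>{u. M u > k}\<close> of the function \<open>M\<close> that is \<open>N\<close> to the left of \<open>a\<close> and
  \<open>max 1 N\<close> on \<open>[a, b)\<close>. Hence \<open>weight b\<close> below is the integral of \<open>M\<close>. The unit that \<open>M\<close> grants on
  \<open>[a, b)\<close> while \<open>N = 0\<close> prepays the first alternation seen from such a \<open>u\<close>, for which
  the injectivity argument on steep pieces would fail.\<close>

definition level :: "nat \<Rightarrow> real \<Rightarrow> real set" where
  "level k b = reach (Suc k) b \<union> (if k = 0 then {a..<b} else {})"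

definition weight :: "real \<Rightarrow> ennreal" where
  "weight b = (\<Sum>k. emeasure lborel (level k b))"

text \<open>The two rays diverge, so no point to the right of \<open>u\<close> is on both sides of one gap.\<close>

lemma hi_less_lo: "u < x \<Longrightarrow> hi x + (\<beta> - \<alpha>) * u < lo x"
  using mult_strict_left_mono[of u x "\<beta> - \<alpha>"] slopes
  by (simp add: lo_def hi_def algebra_simps)

lemma alternatesD: "alternates k up q u \<Longrightarrow> a \<le> q \<and> u < q"
  by (induction k arbitrary: up q) (auto split: if_splits, (force split: if_splits)+)

lemma alternates_SucE:
  assumes "alternates (Suc k) up q u"
  obtains x where "x < q" "alternates k (\<not> up) x u"
    "up \<Longrightarrow> lo x < hi q + (\<beta> - \<alpha>) * u" "\<not> up \<Longrightarrow> lo q < hi x + (\<beta> - \<alpha>) * u"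
  using assms by (auto split: if_splits)

lemma alternates_low_extend:
  assumes "alternates k False q u" "q \<le> q'" "lo q' \<le> lo q"
  shows "alternates k False q' u"
proof (cases k)
  case 0
  with assms show ?thesis by auto
next
  case (Suc j)
  with assms show ?thesis by (auto intro: less_le_trans le_less_trans)
qed

text \<open>All conditions on \<open>u\<close> are strict. This gives the measurability of everything below.\<close>

lemma open_alternates: "open {u. alternates k up q u}"
proof (induction k arbitrary: up q)
  case 0
  show ?case by (cases "a \<le> q") (auto simp: open_Collect_less)
next
  case (Suc k)
  have "{u. alternates (Suc k) up q u} =
    (\<Union>x\<in>{..<q}. {u. alternates k (\<not> up) x u} \<inter>
      {u. if up then lo x < hi q + (\<beta> - \<alpha>) * u else lo q < hi x + (\<beta> - \<alpha>) * u})"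
    by (cases up) auto
  moreover have "open {u. if up then lo x < hi q + (\<beta> - \<alpha>) * u else lo q < hi x + (\<beta> - \<alpha>) * u}" for x
    by (cases up) (auto intro!: open_Collect_less continuous_intros)
  ultimately show ?case
    using Suc by (simp only:) (intro open_UN ballI open_Int)
qed

lemma pred_alternates [measurable]: "Measurable.pred borel (alternates k up q)"
  using borel_open[OF open_alternates[of k up q]] by (simp add: pred_def)

lemma open_reach: "open (reach k b)"
proof -
  have "reach k b = (\<Union>q\<in>{..b}. \<Union>up. {u. alternates k up q u})"
    by (auto simp: reach_def)
  then show ?thesis by (auto intro!: open_alternates)
qed

lemma sets_level [measurable]: "level k b \<in> sets borel"
  using borel_open[OF open_reach] by (auto simp: level_def)

lemma reach_Suc_subset: "reach (Suc k) b \<subseteq> reach k b"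
proof
  fix u assume "u \<in> reach (Suc k) b"
  then obtain q up where "q \<le> b" "alternates (Suc k) up q u" by (auto simp: reach_def simp del: alternates.simps)
  from this(2) obtain x where "x < q" "alternates k (\<not> up) x u"
    by (rule alternates_SucE) blast
  with \<open>q \<le> b\<close> have "x \<le> b" by simp
  with \<open>alternates k (\<not> up) x u\<close> show "u \<in> reach k b"
    unfolding reach_def by blast
qed

lemma level_antimono: "j \<le> k \<Longrightarrow> level k b \<subseteq> level j b"
proof (induction rule: dec_induct)
  case (step n)
  with reach_Suc_subset[of "Suc n" b] show ?case by (auto simp: level_def)
qed simp

text \<open>If the extension from \<open>b\<close> to \<open>c\<close> raises \<open>M\<close> by at most one at every \<open>u\<close> (this is \<open>shift\<close>), then
  the increments of the superlevel sets are disjoint, and the integral grows by no more than the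
  measure of a set that contains them.\<close>

lemma weight_extend:
  assumes shift: "\<And>k. level (Suc k) c \<subseteq> level k b"
    and new: "\<And>k. level k c - level k b \<subseteq> D" and D: "D \<in> sets borel"
  shows "weight c \<le> weight b + emeasure lborel D"
proof -
  define E where "E k = level k c - level k b" for k
  have E: "E k \<in> sets borel" for k
    unfolding E_def by measurable
  have disj: "E j \<inter> E k = {}" if "j < k" for j k
  proof -
    from that obtain i where i: "k = Suc i" "j \<le> i" by (cases k) auto
    then show ?thesis using shift[of i] level_antimono[OF i(2), of b] by (auto simp: E_def)
  qed
  have "disjoint_family E"
    unfolding disjoint_family_on_def
  proof (intro ballI impI)
    fix j k :: nat assume "j \<noteq> k"
    then show "E j \<inter> E k = {}" using disj[of j k] disj[of k j] by (cases "j < k") auto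
  qed
  have "weight c \<le> (\<Sum>k. emeasure lborel (level k b) + emeasure lborel (E k))"
    unfolding weight_def
  proof (intro suminf_le)
    fix k
    have "emeasure lborel (level k c) \<le> emeasure lborel (level k b \<union> E k)"
      by (intro emeasure_mono) (use E in \<open>auto simp: E_def\<close>)
    also have "\<dots> \<le> emeasure lborel (level k b) + emeasure lborel (E k)"
      by (intro emeasure_subadditive) (use E in auto)
    finally show "emeasure lborel (level k c) \<le> emeasure lborel (level k b) + emeasure lborel (E k)" .
  qed auto
  also have "\<dots> = weight b + (\<Sum>k. emeasure lborel (E k))"
    by (simp add: weight_def suminf_add)
  also have "(\<Sum>k. emeasure lborel (E k)) = emeasure lborel (\<Union>k. E k)"
    by (intro suminf_emeasure) (use E \<open>disjoint_family E\<close> in auto)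
  also have "\<dots> \<le> emeasure lborel D"
    by (intro emeasure_mono) (use new D in \<open>auto simp: E_def\<close>)
  finally show ?thesis by (simp add: add_left_mono)
qed

lemma level_start: "level k a = {}"
proof -
  have False if "q \<le> a" "alternates (Suc k) up q u" for q up u
    using that(2)
  proof (rule alternates_SucE)
    fix x assume "x < q" "alternates k (\<not> up) x u"
    with alternatesD[OF this(2)] that(1) show False by simp
  qed
  then have "reach (Suc k) a = {}" by (auto simp: reach_def simp del: alternates.simps)
  then show ?thesis by (auto simp: level_def)
qed

section \<open>Appending an affine piece\<close>

text \<open>Within a piece where \<open>lo\<close> increases and \<open>hi\<close> decreases no side can be changed, and as an end
  point of a sequence every point of the piece can be replaced by its left end \<open>b\<close>.\<close>

lemma flat_piece:
  assumes ab: "a \<le> b" "b < c"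
    and lo: "mono_on {b..c} lo" and hi: "antimono_on {b..c} hi"
  shows "level (Suc k) c \<subseteq> level k b" "level k c - level k b \<subseteq> {b..<c}"
proof -
  have lo_mono: "lo x \<le> lo x'" if "b \<le> x" "x \<le> x'" "x' \<le> c" for x x'
    using that lo by (auto intro: mono_onD)
  have hi_anti: "hi x' \<le> hi x" if "b \<le> x" "x \<le> x'" "x' \<le> c" for x x'
    using that hi by (auto simp: monotone_on_def)
  have reach: "reach (Suc k) c \<subseteq> reach (Suc k) b" for k
  proof
    fix u assume "u \<in> reach (Suc k) c"
    then obtain q up where q: "q \<le> c" "alternates (Suc k) up q u"
      by (auto simp: reach_def simp del: alternates.simps)
    from q(2) obtain x where x: "x < q" "alternates k (\<not> up) x u"
      "up \<Longrightarrow> lo x < hi q + (\<beta> - \<alpha>) * u" "\<not> up \<Longrightarrow> lo q < hi x + (\<beta> - \<alpha>) * u"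
      by (rule alternates_SucE) blast
    have gap: "hi x + (\<beta> - \<alpha>) * u < lo x" using alternatesD[OF x(2)] by (intro hi_less_lo) simp
    have "x < b"
    proof (rule ccontr)
      assume "\<not> x < b"
      with lo_mono[of x q] hi_anti[of x q] x q(1) gap show False by (cases up) auto
    qed
    show "u \<in> reach (Suc k) b"
    proof (cases "q \<le> b")
      case True
      then show ?thesis using q by (auto simp: reach_def simp del: alternates.simps)
    next
      case False
      with lo_mono[of b q] hi_anti[of b q] q(1) x \<open>x < b\<close>
      have "alternates (Suc k) up b u" by (cases up) (auto intro!: exI[of _ x])
      then show ?thesis by (auto simp: reach_def simp del: alternates.simps)
    qed
  qed
  show "level (Suc k) c \<subseteq> level k b"
    using reach[of "Suc k"] reach_Suc_subset[of "Suc k" b] by (auto simp: level_def)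
  show "level k c - level k b \<subseteq> {b..<c}"
    using reach[of k] by (auto simp: level_def)
qed

text \<open>On a piece where both \<open>lo\<close> and \<open>hi\<close> increase a lower point is best placed at \<open>b\<close> and an upper one
  at \<open>c\<close>, and from upper to lower no change is possible. So for \<open>u < b\<close> a
  new longest sequence continues an old one that ends low by the upper point \<open>c\<close>, and from
  \<open>u \<ge> b\<close> at most one change is seen.\<close>

lemma alternates_steep:
  assumes ab: "a \<le> b" "b < c"
    and lo: "mono_on {b..c} lo" and hi: "mono_on {b..c} hi"
    and u: "u \<in> reach (Suc k) c"
  shows "u < b \<Longrightarrow> u \<in> reach (Suc k) b \<or> (\<exists>q\<le>b. alternates k False q u \<and> lo q < hi c + (\<beta> - \<alpha>) * u)"
    and "b \<le> u \<Longrightarrow> k = 0 \<and> u < c"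
proof -
  have lo_mono: "lo x \<le> lo x'" if "b \<le> x" "x \<le> x'" "x' \<le> c" for x x'
    using that lo by (auto intro: mono_onD)
  have hi_mono: "hi x \<le> hi x'" if "b \<le> x" "x \<le> x'" "x' \<le> c" for x x'
    using that hi by (auto intro: mono_onD)
  obtain q up where q: "q \<le> c" "alternates (Suc k) up q u"
    using u by (auto simp: reach_def simp del: alternates.simps)
  from q(2) obtain x where x: "x < q" "alternates k (\<not> up) x u"
    "up \<Longrightarrow> lo x < hi q + (\<beta> - \<alpha>) * u" "\<not> up \<Longrightarrow> lo q < hi x + (\<beta> - \<alpha>) * u"
    by (rule alternates_SucE) blast
  have no_descent: "x' < b" if "x' < q'" "q' \<le> c" "u < x'" "lo q' < hi x' + (\<beta> - \<alpha>) * u" for x' q'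
    using lo_mono[of x' q'] hi_less_lo[OF that(3)] that by force
  have low_to_b: "alternates j False b u" if "alternates j False q' u" "u < b" "b \<le> q'" "q' \<le> c" for j q'
  proof (cases j)
    case 0
    then show ?thesis using ab that by simp
  next
    case (Suc i)
    with that(1) obtain x' where x': "x' < q'" "alternates i True x' u" "lo q' < hi x' + (\<beta> - \<alpha>) * u"
      by auto
    have "x' < b" using no_descent x' that alternatesD by blast
    with x' lo_mono[of b q'] that Suc show ?thesis by (auto intro!: exI[of _ x'])
  qed
  show "u \<in> reach (Suc k) b \<or> (\<exists>q\<le>b. alternates k False q u \<and> lo q < hi c + (\<beta> - \<alpha>) * u)" if "u < b"
  proof (cases "q \<le> b")
    case True
    then show ?thesis using q by (auto simp: reach_def simp del: alternates.simps)
  next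
    case qb: False
    show ?thesis
    proof (cases up)
      case False
      then have "alternates (Suc k) False b u" using low_to_b q qb that by (simp del: alternates.simps)
      then show ?thesis by (auto simp: reach_def simp del: alternates.simps)
    next
      case True
      have less: "lo x < hi c + (\<beta> - \<alpha>) * u" using x(3)[OF True] hi_mono[of q c] q(1) qb by simp
      show ?thesis
      proof (cases "x \<le> b")
        case True
        then show ?thesis using x(2) \<open>up\<close> less by auto
      next
        case False
        then have "alternates k False b u" using low_to_b[of k x] x q \<open>up\<close> that by auto
        moreover have "lo b \<le> lo x" using lo_mono[of b x] x q False by auto
        ultimately show ?thesis using less by force
      qed
    qed
  qed
  show "k = 0 \<and> u < c" if bu: "b \<le> u"
  proof
    have ux: "u < x" using alternatesD[OF x(2)] by simp
    then show "u < c" using x q by simp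
    have up using no_descent[of x q] x q ux bu by force
    show "k = 0"
    proof (rule ccontr)
      assume "k \<noteq> 0"
      then obtain j where "k = Suc j" by (cases k) auto
      with x(2) \<open>up\<close> obtain x' where "x' < x" "alternates j True x' u" "lo x < hi x' + (\<beta> - \<alpha>) * u"
        by auto
      with no_descent[of x' x] alternatesD[of j True x' u] x q bu show False by force
    qed
  qed
qed

text \<open>A finite set of breakpoints of \<open>y\<close> on \<open>[a, b]\<close>. It is stated as a covering by affine stretches with
  end points in \<open>P\<close>, so that no enumeration of \<open>P\<close> is needed and replacing \<open>y\<close> by \<open>-y\<close> changes nothing.\<close>

definition affine_grid :: "real set \<Rightarrow> real \<Rightarrow> bool" where
  "affine_grid P b \<longleftrightarrow> finite P \<and> P \<subseteq> {a..b} \<and>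
     (\<forall>q\<in>{a..b}. \<exists>l\<in>P. \<exists>r\<in>P. l \<le> q \<and> q \<le> r \<and> (\<exists>s d. \<forall>x\<in>{l..r}. y x = s * x + d))"

text \<open>A final lower point can slide down along its affine stretch to a breakpoint. Sliding to the right
  is harmless. Sliding to the left, where \<open>lo\<close> increases, it never meets the upper point before it:
  at that moment one point would be on both sides of a gap. With no point before it, it
  could be stopped only by \<open>u\<close> itself, whence the condition for \<open>k = 0\<close>.\<close>

lemma low_on_grid:
  assumes grid: "affine_grid P b"
    and q: "alternates k False q u" "q \<le> b" and start: "k = 0 \<Longrightarrow> u < a"
  shows "\<exists>p\<in>P. alternates k False p u \<and> lo p \<le> lo q"
proof -
  have "q \<in> {a..b}" using alternatesD[OF q(1)] q(2) by simp
  then obtain l r s d where lr: "l \<in> P" "r \<in> P" "l \<le> q" "q \<le> r" and y: "\<And>x. x \<in> {l..r} \<Longrightarrow> y x = s * x + d"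
    using grid unfolding affine_grid_def by meson
  have lo_eq: "lo x = (s - \<alpha>) * x + d" if "x \<in> {l..r}" for x
    using y[OF that] by (simp add: lo_def algebra_simps)
  show ?thesis
  proof (cases "s \<le> \<alpha>")
    case True
    then have "lo r \<le> lo q" using lr by (simp add: lo_eq mult_left_mono_neg)
    then show ?thesis using alternates_low_extend q lr by blast
  next
    case False
    then have mono: "lo x \<le> lo x'" if "l \<le> x" "x \<le> x'" "x' \<le> r" for x x'
      using that by (simp add: lo_eq mult_left_mono)
    have "alternates k False l u"
    proof (cases k)
      case 0
      moreover have "a \<le> l" using grid lr by (auto simp: affine_grid_def)
      ultimately show ?thesis using start by simp
    next
      case (Suc j)
      with q(1) obtain x where x: "x < q" "alternates j True x u" "lo q < hi x + (\<beta> - \<alpha>) * u"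
        by auto
      have "x < l"
      proof (rule ccontr)
        assume "\<not> x < l"
        with mono[of x q] hi_less_lo[of u x] alternatesD[OF x(2)] x lr show False by simp
      qed
      with x mono[of l q] lr Suc show ?thesis by (auto intro!: exI[of _ x])
    qed
    then show ?thesis using mono[of l q] lr by blast
  qed
qed

text \<open>The set \<open>S r\<close> collects the new \<open>u < b\<close> for which the least value of \<open>lo\<close> at a final lower point of
  a longest sequence is \<open>r\<close>. For injectivity, suppose \<open>u < v\<close> are new with values
  \<open>r\<close>, \<open>t\<close> at breakpoints \<open>p\<close>, \<open>q\<close>, and \<open>r - (\<beta> - \<alpha>) u = t - (\<beta> - \<alpha>) v\<close>. Then \<open>r < t\<close>, so by minimality \<open>p\<close> is
  not available to \<open>v\<close>. This needs an upper point \<open>x\<close> between \<open>p\<close> and \<open>q\<close>, high enough for \<open>v\<close> and \<open>q\<close>.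
  But \<open>x\<close> is then equally high for \<open>u\<close> and \<open>p\<close>, where it would prolong a longest sequence.\<close>

lemma steep_piece:
  assumes ab: "a \<le> b" "b < c" and grid: "affine_grid P b"
    and lo: "mono_on {b..c} lo" and hi: "mono_on {b..c} hi"
  shows "level (Suc k) c \<subseteq> level k b"
    and "weight c \<le> weight b + ennreal ((c - b) + (hi c - hi b) / (\<beta> - \<alpha>))"
proof -
  have hi_mono: "hi x \<le> hi x'" if "b \<le> x" "x \<le> x'" "x' \<le> c" for x x'
    using that hi by (auto intro: mono_onD)
  note steep = alternates_steep[OF ab lo hi]
  show shift: "level (Suc k) c \<subseteq> level k b" for k
  proof
    fix u assume "u \<in> level (Suc k) c"
    then have u: "u \<in> reach (Suc (Suc k)) c" by (simp add: level_def)
    with steep(2)[OF u] have "u < b" by force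
    with steep(1)[OF u] have "u \<in> reach (Suc (Suc k)) b \<or> u \<in> reach (Suc k) b"
      unfolding reach_def by blast
    then have "u \<in> reach (Suc k) b" using reach_Suc_subset by blast
    then show "u \<in> level k b" by (simp add: level_def)
  qed
  define S where "S r = {u. u < b \<and> (\<exists>k. u \<notin> level k b \<and> (\<exists>p\<in>P. lo p = r \<and> alternates k False p u \<and>
      r < hi c + (\<beta> - \<alpha>) * u \<and> (\<forall>p'\<in>P. alternates k False p' u \<longrightarrow> r \<le> lo p')))}" for r
  have finP: "finite P" and P: "P \<subseteq> {a..b}" using grid by (auto simp: affine_grid_def)
  have S_sets: "S r \<in> sets borel" for r
  proof -
    have [measurable]: "Measurable.pred borel (\<lambda>u. u \<in> level k b)" for k
      by (rule pred_sets2[where N=borel]) auto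
    have "Measurable.pred borel (\<lambda>u. u < b \<and> (\<exists>k. u \<notin> level k b \<and> (\<exists>p\<in>P. lo p = r \<and> alternates k False p u \<and>
      r < hi c + (\<beta> - \<alpha>) * u \<and> (\<forall>p'\<in>P. alternates k False p' u \<longrightarrow> r \<le> lo p'))))"
      using finP by measurable
    then show ?thesis by (simp add: S_def pred_def)
  qed
  \<comment> \<open>A longest sequence that ends low cannot be prolonged by an upper point within \<open>[a, b]\<close>.\<close>
  have blocked: "hi x + (\<beta> - \<alpha>) * u \<le> lo q"
    if "u \<notin> level k b" "alternates k False q u" "q \<le> x" "x \<le> b" for u k q x
  proof (cases "q = x")
    case True
    then show ?thesis using hi_less_lo[of u q] alternatesD[OF that(2)] by simp
  next
    case False
    show ?thesis
    proof (rule ccontr)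
      assume "\<not> ?thesis"
      with that False have "alternates (Suc k) True x u" by (auto intro!: exI[of _ q])
      then have "u \<in> reach (Suc k) b" unfolding reach_def using that(4) by blast
      then show False using that(1) by (simp add: level_def)
    qed
  qed
  have reflected: "emeasure lborel (\<Union>r\<in>lo ` P. S r) \<le> ennreal ((hi c - hi b) / (\<beta> - \<alpha>))"
  proof (rule emeasure_le_by_scaled_reflections)
    fix r u assume "u \<in> S r"
    then obtain k p where "u \<notin> level k b" "p \<in> P" "lo p = r" "alternates k False p u"
      "r < hi c + (\<beta> - \<alpha>) * u" by (auto simp: S_def)
    with blocked[of u k p b] P show "r - (\<beta> - \<alpha>) * u \<in> {hi b..hi c}" by auto
  next
    have inj: False if uv: "u \<in> S r" "v \<in> S t" "r - (\<beta> - \<alpha>) * u = t - (\<beta> - \<alpha>) * v" "u < v" for u v r t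
    proof -
      from uv(1) obtain i p where p: "u \<notin> level i b" "p \<in> P" "lo p = r" "alternates i False p u"
        by (auto simp: S_def)
      from uv(2) obtain j q where q: "v < b" "v \<notin> level j b" "q \<in> P" "lo q = t" "alternates j False q v"
        and min: "\<And>p'. p' \<in> P \<Longrightarrow> alternates j False p' v \<Longrightarrow> t \<le> lo p'" by (auto simp: S_def)
      have "(\<beta> - \<alpha>) * u < (\<beta> - \<alpha>) * v" using uv(4) slopes by simp
      then have "r < t" using uv(3) by simp
      then have notp: "\<not> alternates j False p v" using min[OF p(2)] p(3) by auto
      show False
      proof (cases j)
        case 0
        \<comment> \<open>Here the unit granted on \<open>[a, b)\<close> is used: it puts \<open>v\<close> to the left of every breakpoint.\<close>
        then have "v < a" using q by (auto simp: level_def)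
        then show False using notp 0 P p(2) by auto
      next
        case (Suc m)
        with q(5) obtain x where x: "x < q" "alternates m True x v" "lo q < hi x + (\<beta> - \<alpha>) * v"
          by auto
        have "p \<le> x"
        proof (rule ccontr)
          assume "\<not> p \<le> x"
          with x p q \<open>r < t\<close> Suc have "alternates j False p v" by (auto intro!: exI[of _ x])
          with notp show False by simp
        qed
        moreover have "x \<le> b" using x q P by auto
        ultimately have "hi x + (\<beta> - \<alpha>) * u \<le> lo p" by (rule blocked[OF p(1,4)])
        with x uv(3) p q show False by (simp add: algebra_simps)
      qed
    qed
    fix r t u v assume "u \<in> S r" "v \<in> S t" "r - (\<beta> - \<alpha>) * u = t - (\<beta> - \<alpha>) * v"
    then show "u = v" using inj[of u r v t] inj[of v t u r] by (cases u v rule: linorder_cases) auto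
  qed (use finP slopes S_sets in auto)
  have "level k c - level k b \<subseteq> {b..<c} \<union> (\<Union>r\<in>lo ` P. S r)" for k
  proof
    fix u assume u: "u \<in> level k c - level k b"
    show "u \<in> {b..<c} \<union> (\<Union>r\<in>lo ` P. S r)"
    proof (cases "u < b")
      case False
      then show ?thesis using u steep(2)[of u k] by (auto simp: level_def split: if_splits)
    next
      case True
      have start: "k = 0 \<Longrightarrow> u < a" using u True by (auto simp: level_def)
      have "u \<in> reach (Suc k) c" using u True by (auto simp: level_def split: if_splits)
      then obtain q where q: "q \<le> b" "alternates k False q u" "lo q < hi c + (\<beta> - \<alpha>) * u"
        using steep(1)[of u k] True u by (auto simp: level_def)
      obtain p0 where p0: "p0 \<in> P" "alternates k False p0 u" "lo p0 \<le> lo q"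
        using low_on_grid[OF grid q(2,1) start] by blast
      define G where "G = {p \<in> P. alternates k False p u}"
      have "finite G" "G \<noteq> {}" using finP p0 by (auto simp: G_def)
      then obtain p where p: "p \<in> G" "\<And>p'. p' \<in> G \<Longrightarrow> lo p \<le> lo p'"
        by (metis arg_min_if_finite(1) arg_min_least)
      then have "lo p < hi c + (\<beta> - \<alpha>) * u" using p0 q by (force simp: G_def)
      then have "u \<in> S (lo p)" using p True u by (auto simp: G_def S_def)
      then show ?thesis using p by (auto simp: G_def)
    qed
  qed
  moreover have US: "(\<Union>r\<in>lo ` P. S r) \<in> sets borel"
    using finP S_sets by (intro sets.finite_UN) auto
  ultimately have bound: "weight c \<le> weight b + emeasure lborel ({b..<c} \<union> (\<Union>r\<in>lo ` P. S r))"
    by (intro weight_extend shift) auto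
  have "emeasure lborel ({b..<c} \<union> (\<Union>r\<in>lo ` P. S r)) \<le> emeasure lborel {b..<c} + emeasure lborel (\<Union>r\<in>lo ` P. S r)"
    by (intro emeasure_subadditive) (use US in auto)
  also have "\<dots> \<le> ennreal (c - b) + ennreal ((hi c - hi b) / (\<beta> - \<alpha>))"
    using reflected ab by (auto intro!: add_mono)
  also have "\<dots> = ennreal ((c - b) + (hi c - hi b) / (\<beta> - \<alpha>))"
    using hi_mono[of b c] ab slopes by (intro ennreal_plus[symmetric]) auto
  finally show "weight c \<le> weight b + ennreal ((c - b) + (hi c - hi b) / (\<beta> - \<alpha>))"
    using bound by (meson add_left_mono order_trans)
qed

text \<open>Turning the graph upside down interchanges upper and lower points and keeps every gap.\<close>

lemma reflect_alternates:
  "gap.alternates (- \<beta>) (- \<alpha>) a (\<lambda>x. - y x) k up q u \<longleftrightarrow> alternates k (\<not> up) q u"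
proof -
  interpret neg: gap "- \<beta>" "- \<alpha>" a "\<lambda>x. - y x"
    using slopes by unfold_locales simp
  have "neg.lo x = - hi x" "neg.hi x = - lo x" for x
    by (simp_all add: neg.lo_def neg.hi_def lo_def hi_def)
  then show ?thesis
    by (induction k arbitrary: up q) (auto simp: algebra_simps)
qed

lemma reflect_level: "gap.level (- \<beta>) (- \<alpha>) a (\<lambda>x. - y x) k b = level k b"
proof -
  interpret neg: gap "- \<beta>" "- \<alpha>" a "\<lambda>x. - y x"
    using slopes by unfold_locales simp
  have "neg.reach k b = reach k b" for k
    unfolding neg.reach_def reach_def reflect_alternates by (simp add: ex_bool_eq disj_commute)
  then show ?thesis by (simp add: neg.level_def level_def)
qed

lemma affine_piece:
  assumes ab: "a \<le> b" "b < c" and grid: "affine_grid P b"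
    and y: "\<And>x. x \<in> {b..c} \<Longrightarrow> y x = s * x + d"
  shows "level (Suc k) c \<subseteq> level k b"
    and "weight c \<le> weight b + ennreal (tau \<alpha> \<beta> s / (\<beta> - \<alpha>) * (c - b))"
proof -
  have lo_eq: "lo x = (s - \<alpha>) * x + d" and hi_eq: "hi x = (s - \<beta>) * x + d" if "x \<in> {b..c}" for x
    using y[OF that] by (simp_all add: lo_def hi_def algebra_simps)
  have "(\<forall>k. level (Suc k) c \<subseteq> level k b) \<and>
    weight c \<le> weight b + ennreal (tau \<alpha> \<beta> s / (\<beta> - \<alpha>) * (c - b))"
  proof -
    consider (steep) "\<beta> < s" | (flat) "\<alpha> \<le> s" "s \<le> \<beta>" | (down) "s < \<alpha>" by linarith
    then show ?thesis
    proof cases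
      case steep
      have mono: "mono_on {b..c} lo" "mono_on {b..c} hi"
        using steep slopes by (auto simp: mono_on_def lo_eq hi_eq mult_left_mono)
      have "(c - b) + (hi c - hi b) / (\<beta> - \<alpha>) = tau \<alpha> \<beta> s / (\<beta> - \<alpha>) * (c - b)"
        using steep slopes ab by (simp add: tau_def hi_eq field_simps)
      then show ?thesis using steep_piece[OF ab grid mono] by metis
    next
      case flat
      have mono: "mono_on {b..c} lo" "antimono_on {b..c} hi"
        using flat by (auto simp: mono_on_def monotone_on_def lo_eq hi_eq mult_left_mono mult_left_mono_neg)
      note piece = flat_piece[OF ab mono]
      have "weight c \<le> weight b + emeasure lborel {b..<c}"
        by (intro weight_extend piece) auto
      moreover have "tau \<alpha> \<beta> s / (\<beta> - \<alpha>) * (c - b) = c - b"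
        using flat slopes by (auto simp: tau_def)
      ultimately show ?thesis using piece(1) ab by simp
    next
      case down
      interpret neg: gap "- \<beta>" "- \<alpha>" a "\<lambda>x. - y x"
        using slopes by unfold_locales simp
      have neg_lo: "neg.lo x = - hi x" and neg_hi: "neg.hi x = - lo x" for x
        by (simp_all add: neg.lo_def neg.hi_def lo_def hi_def)
      have mono: "mono_on {b..c} neg.lo" "mono_on {b..c} neg.hi"
        using down slopes by (auto simp: mono_on_def neg_lo neg_hi lo_eq hi_eq mult_left_mono_neg)
      have neg_grid: "neg.affine_grid P b"
        unfolding neg.affine_grid_def
      proof (intro conjI ballI)
        fix q assume "q \<in> {a..b}"
        then obtain l r s d where "l \<in> P" "r \<in> P" "l \<le> q" "q \<le> r" and y: "\<And>x. x \<in> {l..r} \<Longrightarrow> y x = s * x + d"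
          using grid unfolding affine_grid_def by meson
        moreover have "\<forall>x\<in>{l..r}. - y x = (- s) * x + (- d)" using y by simp
        ultimately show "\<exists>l\<in>P. \<exists>r\<in>P. l \<le> q \<and> q \<le> r \<and> (\<exists>s d. \<forall>x\<in>{l..r}. - y x = s * x + d)"
          by blast
      qed (use grid in \<open>auto simp: affine_grid_def\<close>)
      have "neg.weight x = weight x" for x
        by (simp add: neg.weight_def weight_def reflect_level)
      moreover have "(c - b) + (neg.hi c - neg.hi b) / (- \<alpha> - - \<beta>) = tau \<alpha> \<beta> s / (\<beta> - \<alpha>) * (c - b)"
        using down slopes ab by (simp add: tau_def neg_hi lo_eq field_simps)
      ultimately show ?thesis
        using neg.steep_piece[OF ab neg_grid mono] unfolding reflect_level by metis
    qed
  qed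
  then show "level (Suc k) c \<subseteq> level k b"
    and "weight c \<le> weight b + ennreal (tau \<alpha> \<beta> s / (\<beta> - \<alpha>) * (c - b))" by blast+
qed

section \<open>The inequality for the superlevel sets\<close>

lemma weight_le_sum_tau:
  fixes n :: nat
  assumes p0: "p 0 = a" and p: "\<And>i. i < n \<Longrightarrow> p i < p (Suc i)"
    and y: "\<And>i x. i < n \<Longrightarrow> x \<in> {p i..p (Suc i)} \<Longrightarrow> y x = s i * x + d i"
  shows "level n (p n) = {}"
    and "weight (p n) \<le> ennreal (\<Sum>i<n. tau \<alpha> \<beta> (s i) / (\<beta> - \<alpha>) * (p (Suc i) - p i))"
proof -
  let ?w = "\<lambda>i. tau \<alpha> \<beta> (s i) / (\<beta> - \<alpha>) * (p (Suc i) - p i)"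
  have w: "0 \<le> ?w i" if "i < n" for i
    using slopes p[OF that] by (auto simp: tau_def intro!: mult_nonneg_nonneg)
  have "a \<le> p m \<and> affine_grid (p ` {..m}) (p m) \<and> level m (p m) = {} \<and> weight (p m) \<le> ennreal (\<Sum>i<m. ?w i)"
    if "m \<le> n" for m
    using that
  proof (induction m)
    case 0
    have "\<exists>s d. \<forall>x\<in>{a..a}. y x = s * x + d" by (rule exI[of _ 0]) auto
    then show ?case by (auto simp: p0 affine_grid_def level_start weight_def)
  next
    case (Suc m)
    then have ge: "a \<le> p m" and grid: "affine_grid (p ` {..m}) (p m)" and
      empty: "level m (p m) = {}" and le: "weight (p m) \<le> ennreal (\<Sum>i<m. ?w i)" and m: "m < n"
      by auto
    note piece = affine_piece[OF ge p[OF m] grid y[OF m]]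
    have "affine_grid (p ` {..Suc m}) (p (Suc m))"
      unfolding affine_grid_def
    proof (intro conjI ballI)
      show "p ` {..Suc m} \<subseteq> {a..p (Suc m)}"
      proof -
        have "p ` {..m} \<subseteq> {a..p m}" using grid by (simp add: affine_grid_def)
        moreover have "{a..p m} \<subseteq> {a..p (Suc m)}" "p (Suc m) \<in> {a..p (Suc m)}"
          using ge p[OF m] by auto
        ultimately show ?thesis unfolding atMost_Suc image_insert by blast
      qed
      fix q assume q: "q \<in> {a..p (Suc m)}"
      show "\<exists>l\<in>p ` {..Suc m}. \<exists>r\<in>p ` {..Suc m}. l \<le> q \<and> q \<le> r \<and> (\<exists>s d. \<forall>x\<in>{l..r}. y x = s * x + d)"
      proof (cases "q \<le> p m")
        case True
        then have "\<exists>l\<in>p ` {..m}. \<exists>r\<in>p ` {..m}. l \<le> q \<and> q \<le> r \<and> (\<exists>s d. \<forall>x\<in>{l..r}. y x = s * x + d)"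
          using grid q unfolding affine_grid_def by auto
        moreover have "p ` {..m} \<subseteq> p ` {..Suc m}" by auto
        ultimately show ?thesis by (meson subsetD)
      next
        case False
        then show ?thesis using q y[OF m]
          by (intro bexI[of _ "p m"] bexI[of _ "p (Suc m)"]) auto
      qed
    qed simp
    moreover have "level (Suc m) (p (Suc m)) = {}" using piece(1)[of m] empty by blast
    moreover have "weight (p (Suc m)) \<le> ennreal (\<Sum>i<Suc m. ?w i)"
    proof -
      have "weight (p (Suc m)) \<le> ennreal (\<Sum>i<m. ?w i) + ennreal (?w m)"
        using piece(2) le by (meson add_right_mono order_trans)
      also have "\<dots> = ennreal ((\<Sum>i<m. ?w i) + ?w m)"
        using w m by (intro ennreal_plus[symmetric] sum_nonneg) auto
      finally show ?thesis by simp
    qed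
    ultimately show ?case using ge p[OF m] by simp
  qed
  then show "level n (p n) = {}" "weight (p n) \<le> ennreal (\<Sum>i<n. ?w i)" by blast+
qed

section \<open>From crossings of one gap to alternating sequences\<close>

text \<open>A sequence that crosses one gap with vertex on the vertical line at \<open>u\<close> is alternating for \<open>u\<close>,
  with the same \<open>v\<close> for all pairs.\<close>

lemma crossing_in_level:
  assumes "alternating_sequence \<alpha> \<beta> a b y u v (Suc m) x"
  shows "u \<in> level m b"
proof -
  from assms have x: "\<And>i. i \<le> Suc m \<Longrightarrow> x i \<in> {a..b}" "\<And>i. i \<le> m \<Longrightarrow> x i < x (Suc i)"
    by (auto simp: alternating_sequence_def)
  from assms have "(\<forall>i\<le>Suc m. if even i then below_alpha_ray \<alpha> u v (x i, y (x i)) else above_beta_ray \<beta> u v (x i, y (x i))) \<or>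
      (\<forall>i\<le>Suc m. if even i then above_beta_ray \<beta> u v (x i, y (x i)) else below_alpha_ray \<alpha> u v (x i, y (x i)))"
    unfolding alternating_sequence_def by blast
  then have "\<exists>h. \<forall>i\<le>Suc m. if even i = h then above_beta_ray \<beta> u v (x i, y (x i))
      else below_alpha_ray \<alpha> u v (x i, y (x i))"
  proof
    assume "\<forall>i\<le>Suc m. if even i then below_alpha_ray \<alpha> u v (x i, y (x i)) else above_beta_ray \<beta> u v (x i, y (x i))"
    then show ?thesis by (intro exI[of _ False]) auto
  next
    assume "\<forall>i\<le>Suc m. if even i then above_beta_ray \<beta> u v (x i, y (x i)) else below_alpha_ray \<alpha> u v (x i, y (x i))"
    then show ?thesis by (intro exI[of _ True]) auto
  qed
  then obtain h where h: "\<And>i. i \<le> Suc m \<Longrightarrow> if even i = h then above_beta_ray \<beta> u v (x i, y (x i))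
      else below_alpha_ray \<alpha> u v (x i, y (x i))"
    by blast
  have above: "u < x i" "v - \<beta> * u < hi (x i)" if "i \<le> Suc m" "even i = h" for i
    using h[OF that(1)] that(2) by (auto simp: above_beta_ray_def hi_def algebra_simps)
  have below: "u < x i" "lo (x i) < v - \<alpha> * u" if "i \<le> Suc m" "even i \<noteq> h" for i
    using h[OF that(1)] that(2) by (auto simp: below_alpha_ray_def lo_def algebra_simps)
  have alt: "alternates i (even i = h) (x i) u" if "i \<le> Suc m" for i
    using that
  proof (induction i)
    case 0
    then show ?case using x(1)[of 0] above(1)[of 0] below(1)[of 0] by (cases h) auto
  next
    case (Suc i)
    then have "alternates i (\<not> (even (Suc i) = h)) (x i) u" by simp
    moreover have "if even (Suc i) = h then lo (x i) < hi (x (Suc i)) + (\<beta> - \<alpha>) * u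
        else lo (x (Suc i)) < hi (x i) + (\<beta> - \<alpha>) * u"
      using above[of i] above[of "Suc i"] below[of i] below[of "Suc i"] Suc.prems
      by (auto simp: algebra_simps)
    ultimately show ?case using x(2)[of i] Suc.prems by (auto intro!: exI[of _ "x i"])
  qed
  have "x (Suc m) \<le> b" using x(1) by simp
  with alt[of "Suc m"] show ?thesis
    unfolding level_def reach_def by blast
qed

end

section \<open>Piecewise linear functions and measurability\<close>

lemma affine_on_closed_interval:
  fixes y :: "real \<Rightarrow> real"
  assumes "continuous_on {l..r} y" "l < r" "\<And>x. x \<in> {l<..<r} \<Longrightarrow> y x = s * x + d" "x \<in> {l..r}"
  shows "y x = s * x + d"
proof -
  have "continuous_on (closure {l<..<r}) (\<lambda>x. y x - (s * x + d))"
    using assms(1,2) by (auto intro!: continuous_intros)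
  then have "y x - (s * x + d) = 0"
    by (rule continuous_constant_on_closure) (use assms in auto)
  then show ?thesis by simp
qed

lemma set_integral_of_step_function:
  fixes g :: "real \<Rightarrow> real" and n :: nat
  assumes p: "\<And>i. i < n \<Longrightarrow> p i < p (Suc i)"
    and g: "\<And>i x. i < n \<Longrightarrow> x \<in> {p i<..<p (Suc i)} \<Longrightarrow> g x = c i"
  shows "(LINT x:{p 0..p n}|lborel. g x) = (\<Sum>i<n. c i * (p (Suc i) - p i))"
proof -
  have point: "set_integrable lborel {t} g \<and> (LINT x:{t}|lborel. g x) = 0" for t
  proof -
    have "(\<lambda>x. indicator {t} x *\<^sub>R g x) = (\<lambda>x. indicator {t} x *\<^sub>R g t)"
      by (auto simp: fun_eq_iff indicator_def)
    then show ?thesis by (simp add: set_integrable_def set_lebesgue_integral_def)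
  qed
  have "p 0 \<le> p m \<and> set_integrable lborel {p 0..p m} g \<and>
    (LINT x:{p 0..p m}|lborel. g x) = (\<Sum>i<m. c i * (p (Suc i) - p i))" if "m \<le> n" for m
    using that
  proof (induction m)
    case 0
    then show ?case using point by simp
  next
    case (Suc m)
    then have IH: "p 0 \<le> p m" "set_integrable lborel {p 0..p m} g"
      "(LINT x:{p 0..p m}|lborel. g x) = (\<Sum>i<m. c i * (p (Suc i) - p i))" and m: "m < n" by auto
    have "(\<lambda>x. indicator {p m<..<p (Suc m)} x *\<^sub>R g x) = (\<lambda>x. indicator {p m<..<p (Suc m)} x *\<^sub>R c m)"
      using g[OF m] by (auto simp: fun_eq_iff indicator_def)
    then have "set_integrable lborel {p m<..<p (Suc m)} g"
      "(LINT x:{p m<..<p (Suc m)}|lborel. g x) = c m * (p (Suc m) - p m)"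
      using p[OF m] by (simp_all add: set_integrable_def set_lebesgue_integral_def)
    then have "set_integrable lborel ({p m<..<p (Suc m)} \<union> {p (Suc m)}) g \<and>
      (LINT x:({p m<..<p (Suc m)} \<union> {p (Suc m)})|lborel. g x) = c m * (p (Suc m) - p m)"
      using point by (intro conjI set_integrable_Un) (auto simp: set_integral_Un simp del: Un_insert_right)
    moreover have "{p m<..<p (Suc m)} \<union> {p (Suc m)} = {p m<..p (Suc m)}"
      using p[OF m] by auto
    ultimately have "set_integrable lborel {p m<..p (Suc m)} g"
      "(LINT x:{p m<..p (Suc m)}|lborel. g x) = c m * (p (Suc m) - p m)"
      by simp_all
    then have "set_integrable lborel ({p 0..p m} \<union> {p m<..p (Suc m)}) g \<and>
      (LINT x:({p 0..p m} \<union> {p m<..p (Suc m)})|lborel. g x) = (\<Sum>i<Suc m. c i * (p (Suc i) - p i))"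
      using IH by (intro conjI set_integrable_Un) (simp_all add: set_integral_Un Int_def)
    moreover have "{p 0..p m} \<union> {p m<..p (Suc m)} = {p 0..p (Suc m)}"
      using IH(1) p[OF m] by auto
    ultimately show ?case using IH(1) p[OF m] by simp
  qed
  then show ?thesis by blast
qed

text \<open>The points of the sequence and \<open>v\<close> stay fixed while \<open>u\<close> varies. Therefore the sets where the maximal
  number of crossings exceeds \<open>k\<close> are unions of open sets.\<close>

lemma open_alternating_sequence: "open {u. alternating_sequence \<alpha> \<beta> a b y u v m x}"
proof -
  define P where "P i u \<longleftrightarrow> (if even i then below_alpha_ray \<alpha> u v (x i, y (x i))
    else above_beta_ray \<beta> u v (x i, y (x i)))" for i u
  define Q where "Q i u \<longleftrightarrow> (if even i then above_beta_ray \<beta> u v (x i, y (x i))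
    else below_alpha_ray \<alpha> u v (x i, y (x i)))" for i u
  have "open {u. below_alpha_ray \<alpha> u v (x i, y (x i))}" "open {u. above_beta_ray \<beta> u v (x i, y (x i))}" for i
    by (auto simp: below_alpha_ray_def above_beta_ray_def
        intro!: open_Collect_conj open_Collect_less continuous_intros)
  then have PQ: "open {u. P i u}" "open {u. Q i u}" for i
    unfolding P_def Q_def by (cases "even i"; simp)+
  have "{u. alternating_sequence \<alpha> \<beta> a b y u v m x} =
    (if (\<forall>i\<le>m. x i \<in> {a..b}) \<and> (\<forall>i<m. x i < x (Suc i))
     then (\<Inter>i\<in>{..m}. {u. P i u}) \<union> (\<Inter>i\<in>{..m}. {u. Q i u}) else {})"
    unfolding alternating_sequence_def P_def[symmetric] Q_def[symmetric] by auto
  then show ?thesis using PQ by (auto intro!: open_Un open_INT)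
qed

section \<open>The bound on the maximal number of crossings\<close>

theorem theorem3:
  fixes \<alpha> \<beta> a b :: real and y :: "real \<Rightarrow> real"
  assumes "\<alpha> < \<beta>" and "a < b"
    and "continuous_on {a..b} y"
    and "piecewise_linear_on a b y"
  shows "(\<forall>u v. finite (crossing_counts \<alpha> \<beta> a b y u v)) \<and>
         (\<forall>u. finite (range (\<lambda>v. num_crossings \<alpha> \<beta> a b y u v))) \<and>
         integrable lborel (\<lambda>u. real (max_crossings \<alpha> \<beta> a b y u)) \<and>
         (LINT u|lborel. real (max_crossings \<alpha> \<beta> a b y u))
           \<le> 1 / (\<beta> - \<alpha>) * (LINT x:{a..b}|lborel. tau \<alpha> \<beta> (deriv y x))"
proof -
  interpret gap \<alpha> \<beta> a y using assms(1) by unfold_locales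
  obtain n :: nat and p where p: "p 0 = a" "p n = b" "\<And>i. i < n \<Longrightarrow> p i < p (Suc i)"
    and "\<forall>i<n. \<exists>s d. \<forall>x\<in>{p i<..<p (Suc i)}. y x = s * x + d"
    using assms(4) unfolding piecewise_linear_on_def by metis
  then obtain s d where sd: "\<And>i x. i < n \<Longrightarrow> x \<in> {p i<..<p (Suc i)} \<Longrightarrow> y x = s i * x + d i"
    by metis
  have p_mono: "p i \<le> p j" if "i \<le> j" "j \<le> n" for i j
    using that
  proof (induction rule: dec_induct)
    case (step k)
    then show ?case using p(3)[of k] by simp
  qed simp
  have y: "y x = s i * x + d i" if i: "i < n" "x \<in> {p i..p (Suc i)}" for i x
  proof (rule affine_on_closed_interval[OF _ p(3)[OF i(1)] sd[OF i(1)] i(2)])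
    have "{p i..p (Suc i)} \<subseteq> {a..b}"
      using p_mono[of 0 i] p_mono[of "Suc i" n] i(1) p(1,2) by auto
    then show "continuous_on {p i..p (Suc i)} y" using assms(3) continuous_on_subset by blast
  qed
  define T where "T = max_crossings \<alpha> \<beta> a b y"
  define I where "I = (LINT x:{a..b}|lborel. tau \<alpha> \<beta> (deriv y x))"

  have empty: "level n b = {}" and total: "weight b \<le> ennreal (1 / (\<beta> - \<alpha>) * I)"
  proof -
    have deriv: "tau \<alpha> \<beta> (deriv y x) = tau \<alpha> \<beta> (s i)" if "i < n" "x \<in> {p i<..<p (Suc i)}" for i x
    proof -
      have "((\<lambda>x. s i * x + d i) has_field_derivative s i) (at x)"
        by (auto intro!: derivative_eq_intros)
      then have "(y has_field_derivative s i) (at x)"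
        by (rule has_field_derivative_transform_within_open[where S="{p i<..<p (Suc i)}"])
          (use that sd in auto)
      then show ?thesis by (simp add: DERIV_imp_deriv)
    qed
    have "I = (\<Sum>i<n. tau \<alpha> \<beta> (s i) * (p (Suc i) - p i))"
      using set_integral_of_step_function[of n p "\<lambda>x. tau \<alpha> \<beta> (deriv y x)" "\<lambda>i. tau \<alpha> \<beta> (s i)"] p deriv
      by (simp add: I_def)
    then have "(\<Sum>i<n. tau \<alpha> \<beta> (s i) / (\<beta> - \<alpha>) * (p (Suc i) - p i)) = 1 / (\<beta> - \<alpha>) * I"
      by (simp add: sum_distrib_left)
    then show "level n b = {}" "weight b \<le> ennreal (1 / (\<beta> - \<alpha>) * I)"
      using weight_le_sum_tau[of p n s d] p y by auto
  qed

  have count_level: "u \<in> level k b" if "m \<in> crossing_counts \<alpha> \<beta> a b y u v" "k < m" for k m u v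
  proof -
    from \<open>k < m\<close> obtain j where j: "m = Suc j" "k \<le> j" by (cases m) auto
    with that crossing_in_level have "u \<in> level j b" by (auto simp: crossing_counts_def)
    with level_antimono[OF j(2)] show ?thesis by blast
  qed
  have counts: "crossing_counts \<alpha> \<beta> a b y u v \<subseteq> {..n}" for u v
    using count_level[where k=n] empty by (force simp: not_le)
  then have finite_counts: "finite (crossing_counts \<alpha> \<beta> a b y u v)" for u v
    using finite_subset by blast
  have num_iff: "k < num_crossings \<alpha> \<beta> a b y u v \<longleftrightarrow> (\<exists>m\<in>crossing_counts \<alpha> \<beta> a b y u v. k < m)" for k u v
    using finite_counts by (simp add: num_crossings_def Max_gr_iff)
  have "range (\<lambda>v. num_crossings \<alpha> \<beta> a b y u v) \<subseteq> {..n}" for u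
    using num_iff[of n] counts by (force simp: not_le)
  then have finite_num: "finite (range (\<lambda>v. num_crossings \<alpha> \<beta> a b y u v))" for u
    using finite_subset by blast
  have T_iff: "k < T u \<longleftrightarrow> (\<exists>v. \<exists>m\<in>crossing_counts \<alpha> \<beta> a b y u v. k < m)" for k u
    using finite_num[of u] by (simp add: T_def max_crossings_def Max_gr_iff num_iff)

  have [measurable]: "(\<lambda>u. real (T u)) \<in> borel_measurable lborel"
  proof (rule borel_measurableI_greater)
    fix r :: real
    have "{u. k < T u} = (\<Union>v. \<Union>m\<in>{k<..}. \<Union>x. {u. alternating_sequence \<alpha> \<beta> a b y u v m x})" for k
      by (auto simp: T_iff crossing_counts_def)
    then have "{u. k < T u} \<in> sets borel" for k
      by (intro borel_open) (auto intro!: open_UN open_alternating_sequence)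
    moreover have "{u. r < real (T u)} = (if r < 0 then UNIV else {u. nat \<lfloor>r\<rfloor> < T u})"
      by (auto simp: nat_less_iff floor_less_iff)
    ultimately show "{u \<in> space lborel. r < real (T u)} \<in> sets lborel" by simp
  qed
  have "ennreal (real (T u)) \<le> (\<Sum>k. indicator (level k b) u)" for u
  proof -
    have "u \<in> level k b" if "k < T u" for k
      using that count_level by (auto simp: T_iff)
    then have "ennreal (real (T u)) = (\<Sum>k<T u. indicator (level k b) u)"
      by (simp add: ennreal_of_nat_eq_real_of_nat)
    also have "\<dots> \<le> (\<Sum>k. indicator (level k b) u)" by (intro sum_le_suminf) auto
    finally show ?thesis .
  qed
  then have "(\<integral>\<^sup>+u. ennreal (real (T u)) \<partial>lborel) \<le> (\<integral>\<^sup>+u. (\<Sum>k. indicator (level k b) u) \<partial>lborel)"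
    by (intro nn_integral_mono)
  also have "\<dots> = weight b"
    by (simp add: nn_integral_suminf weight_def)
  finally have nn: "(\<integral>\<^sup>+u. ennreal (real (T u)) \<partial>lborel) \<le> ennreal (1 / (\<beta> - \<alpha>) * I)"
    using total by simp
  then have "integrable lborel (\<lambda>u. real (T u))"
    by (intro integrableI_nonneg) (auto simp: le_less_trans)
  moreover have "(LINT u|lborel. real (T u)) \<le> 1 / (\<beta> - \<alpha>) * I"
  proof (rule integral_real_bounded[OF _ nn])
    have "0 \<le> I"
      unfolding I_def set_lebesgue_integral_def using assms(1)
      by (intro Bochner_Integration.integral_nonneg) (auto simp: tau_def indicator_def)
    then show "0 \<le> 1 / (\<beta> - \<alpha>) * I" using assms(1) by simp
  qed
  ultimately show ?thesis
    using finite_counts finite_num unfolding T_def I_def by blast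
qed

end
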